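(* Suppose that the datapoints $(Z_i)_{i\ge 1}$ are i.i.d. copies of a random element $Z_0$. Let $(\bar h_n)_n$ be a sequence of real-valued functions on $\mathcal Z$, let $\sigma_n^2=\operatorname{Var}(\bar h_n(Z_0))\in(0,\infty)$, and suppose that the sequence $\big((\bar h_n(Z_0)-\mathbb E[\bar h_n(Z_0)])^2/\sigma_n^2\big)_n$ is uniformly integrable. If $$\frac{1}{\sigma_n\sqrt n}\sum_{j=1}^k\sum_{i\in B_j'}\Big(h_n(Z_i,Z_{B_j})-\mathbb E[h_n(Z_i,Z_{B_j})\mid Z_{B_j}]-\big(\bar h_n(Z_i)-\mathbb E[\bar h_n(Z_i)]\big)\Big)\to 0\quad\text{in probability}$$ as $n\to\infty$, then $$\frac{\sqrt n}{\sigma_n}\,(\hat R_n-R_n)\to \mathcal N(0,1)\quad\text{in distribution as } n\to\infty.$$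
   Context: $(Z_i)_{i\ge1}$ is a sequence of random elements of a (measurable) set $\mathcal Z$. For each sample size $n$, $k=k_n\ge 2$ is a number of folds, possibly depending on $n$, which divides $n$ evenly, and $\{(B_j,B_j')\}_{j=1}^k$ are (non-random) train-validation splits: $B_j$ and $B_j'$ are vectors of distinct indices in $[n]=\{1,\dots,n\}$ which together partition $[n]$, and the validation index vectors $B_1',\dots,B_k'$ partition $[n]$ into $k$ folds of size $n/k$. For a vector $B$ of indices, $Z_B$ is the subvector of $Z_{1:n}=(Z_1,\dots,Z_n)$ with the ordered indices in $B$. $h_n$ is a real-valued (measurable) loss function taking a test point and a training vector (not assumed symmetric in the training points), and all expectations that appear are assumed to be well defined. The $k$-fold cross-validation error and $k$-fold test error are $$\hat R_n=\frac1n\sum_{j=1}^k\sum_{i\in B_j'}h_n(Z_i,Z_{B_j}),\qquad R_n=\frac1n\sum_{j=1}^k\sum_{i\in B_j'}\mathbb E[h_n(Z_i,Z_{B_j})\mid Z_{B_j}].$$ *)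

theory Defs
  imports "HOL-Probability.Probability"
begin

text \<open>The splits are indexed by \<open>j = 1, \<dots>, k\<close>; index vectors are lists with entries in \<open>{1..n}\<close>.
  Every training vector then has length \<open>n - n div k\<close>.\<close>

definition cv_splits :: "nat \<Rightarrow> nat \<Rightarrow> (nat \<Rightarrow> nat list) \<Rightarrow> (nat \<Rightarrow> nat list) \<Rightarrow> bool" where
  "cv_splits n k B B' \<longleftrightarrow>
     2 \<le> k \<and> k dvd n \<and>
     (\<forall>j\<in>{1..k}. distinct (B j) \<and> distinct (B' j) \<and>
        set (B j) \<inter> set (B' j) = {} \<and> set (B j) \<union> set (B' j) = {1..n} \<and>
        length (B' j) = n div k) \<and>
     disjoint_family_on (\<lambda>j. set (B' j)) {1..k} \<and>
     (\<Union>j\<in>{1..k}. set (B' j)) = {1..n}"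

text \<open>A vector of length \<open>m\<close> over \<open>S\<close> is a point of \<open>PiM {..<m} (\<lambda>_. S)\<close>, so that vectors
  carry the product sigma-algebra.\<close>

abbreviation vec_space :: "'z measure \<Rightarrow> nat \<Rightarrow> (nat \<Rightarrow> 'z) measure" where
  "vec_space S m \<equiv> PiM {..<m} (\<lambda>_. S)"

definition subvector :: "(nat \<Rightarrow> 'a \<Rightarrow> 'z) \<Rightarrow> nat list \<Rightarrow> 'a \<Rightarrow> (nat \<Rightarrow> 'z)" where
  "subvector Z B \<omega> = (\<lambda>l\<in>{..<length B}. Z (B ! l) \<omega>)"

definition sigma_subvector ::
    "'a measure \<Rightarrow> 'z measure \<Rightarrow> (nat \<Rightarrow> 'a \<Rightarrow> 'z) \<Rightarrow> nat list \<Rightarrow> 'a measure" where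
  "sigma_subvector M S Z B = vimage_algebra (space M) (subvector Z B) (vec_space S (length B))"

definition loss_at ::
    "('z \<Rightarrow> (nat \<Rightarrow> 'z) \<Rightarrow> real) \<Rightarrow> (nat \<Rightarrow> 'a \<Rightarrow> 'z) \<Rightarrow> nat list \<Rightarrow> nat \<Rightarrow> 'a \<Rightarrow> real" where
  "loss_at h Z B i \<omega> = h (Z i \<omega>) (subvector Z B \<omega>)"

definition cond_loss ::
    "'a measure \<Rightarrow> 'z measure \<Rightarrow> ('z \<Rightarrow> (nat \<Rightarrow> 'z) \<Rightarrow> real) \<Rightarrow> (nat \<Rightarrow> 'a \<Rightarrow> 'z) \<Rightarrow>
     nat list \<Rightarrow> nat \<Rightarrow> 'a \<Rightarrow> real" where
  "cond_loss M S h Z B i = real_cond_exp M (sigma_subvector M S Z B) (loss_at h Z B i)"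

text \<open>This is what makes the conditional expectation of \<open>f\<close> given \<open>F\<close> well defined and finite:
  \<open>real_cond_exp M F f\<close> is the difference of the conditional expectations of the positive and
  negative parts. It is implied by integrability of \<open>f\<close>.\<close>

definition cond_integrable :: "'a measure \<Rightarrow> 'a measure \<Rightarrow> ('a \<Rightarrow> real) \<Rightarrow> bool" where
  "cond_integrable M F f \<longleftrightarrow>
     f \<in> borel_measurable M \<and> (AE \<omega> in M. nn_cond_exp M F (\<lambda>\<omega>. ennreal \<bar>f \<omega>\<bar>) \<omega> < \<infinity>)"

definition cv_error ::
    "nat \<Rightarrow> nat \<Rightarrow> (nat \<Rightarrow> nat list) \<Rightarrow> (nat \<Rightarrow> nat list) \<Rightarrow>
     ('z \<Rightarrow> (nat \<Rightarrow> 'z) \<Rightarrow> real) \<Rightarrow> (nat \<Rightarrow> 'a \<Rightarrow> 'z) \<Rightarrow> 'a \<Rightarrow> real" where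
  "cv_error n k B B' h Z \<omega> =
     1 / real n * (\<Sum>j=1..k. \<Sum>i\<in>set (B' j). loss_at h Z (B j) i \<omega>)"

definition cv_test_error ::
    "'a measure \<Rightarrow> 'z measure \<Rightarrow> nat \<Rightarrow> nat \<Rightarrow> (nat \<Rightarrow> nat list) \<Rightarrow> (nat \<Rightarrow> nat list) \<Rightarrow>
     ('z \<Rightarrow> (nat \<Rightarrow> 'z) \<Rightarrow> real) \<Rightarrow> (nat \<Rightarrow> 'a \<Rightarrow> 'z) \<Rightarrow> 'a \<Rightarrow> real" where
  "cv_test_error M S n k B B' h Z \<omega> =
     1 / real n * (\<Sum>j=1..k. \<Sum>i\<in>set (B' j). cond_loss M S h Z (B j) i \<omega>)"

definition uniformly_integrable :: "'a measure \<Rightarrow> 'i set \<Rightarrow> ('i \<Rightarrow> 'a \<Rightarrow> real) \<Rightarrow> bool" where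
  "uniformly_integrable M I X \<longleftrightarrow>
     (\<forall>i\<in>I. X i \<in> borel_measurable M) \<and>
     ((\<lambda>K::real. SUP i\<in>I. \<integral>\<^sup>+\<omega>. ennreal \<bar>X i \<omega>\<bar> * indicator {\<omega>. K < \<bar>X i \<omega>\<bar>} \<omega> \<partial>M)
        \<longlongrightarrow> 0) at_top"

definition conv_in_prob :: "'a measure \<Rightarrow> (nat \<Rightarrow> 'a \<Rightarrow> real) \<Rightarrow> ('a \<Rightarrow> real) \<Rightarrow> bool" where
  "conv_in_prob M X Y \<longleftrightarrow>
     (\<forall>\<epsilon>>0. (\<lambda>n. measure M {\<omega>\<in>space M. \<epsilon> < \<bar>X n \<omega> - Y \<omega>\<bar>}) \<longlonglongrightarrow> 0)"

end

theory Submission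
  imports Defs
begin

text \<open>Because the validation folds partition \<open>{1..n}\<close>, the double sum of the centred
  \<open>hbar n (Z i)\<close> over folds is a single sum of \<open>n\<close> i.i.d. terms. The scaled cross-validation
  deviation is therefore the remainder, negligible by hypothesis, plus a row sum of a triangular
  array, which obeys a central limit theorem: within a row the terms are identically distributed,
  so uniform integrability of the squares is enough for the Taylor estimate of the characteristic
  functions to be uniform over the rows. Slutsky's lemma combines the two parts.\<close>

section \<open>Reindexing and shifts of sequences\<close>

lemma uniformly_integrable_reindex:
  assumes "uniformly_integrable M (f ` J) X"
  shows "uniformly_integrable M J (\<lambda>j. X (f j))"
  using assms unfolding uniformly_integrable_def by (simp add: image_image)

lemma weak_conv_m_offset:
  assumes "weak_conv_m (\<lambda>n. N (n + d)) N'"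
  shows "weak_conv_m N N'"
  unfolding weak_conv_m_def weak_conv_def
proof (intro allI impI)
  fix x assume "isCont (cdf N') x"
  then have "(\<lambda>n. cdf (N (n + d)) x) \<longlonglongrightarrow> cdf N' x"
    using assms unfolding weak_conv_m_def weak_conv_def by simp
  then show "(\<lambda>n. cdf (N n) x) \<longlonglongrightarrow> cdf N' x"
    by (rule LIMSEQ_offset)
qed

lemma conv_in_prob_shift:
  assumes "conv_in_prob M X Y"
  shows "conv_in_prob M (\<lambda>n. X (n + d)) Y"
  unfolding conv_in_prob_def
proof (intro allI impI)
  fix e :: real assume "0 < e"
  then have "(\<lambda>n. measure M {\<omega>\<in>space M. e < \<bar>X n \<omega> - Y \<omega>\<bar>}) \<longlonglongrightarrow> 0"
    using assms unfolding conv_in_prob_def by simp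
  then show "(\<lambda>n. measure M {\<omega>\<in>space M. e < \<bar>X (n + d) \<omega> - Y \<omega>\<bar>}) \<longlonglongrightarrow> 0"
    by (rule LIMSEQ_ignore_initial_segment)
qed

section \<open>Slutsky's lemma through characteristic functions\<close>

context prob_space
begin

text \<open>The expectation of \<open>iexp (t * Y) - iexp (t * X)\<close> is split on the event that
  \<open>X\<close> and \<open>Y\<close> differ by more than \<open>e\<close>. Off the event the
  Lipschitz bound for \<open>iexp\<close> gives at most \<open>\<bar>t\<bar> * e\<close>; on it two
  numbers of modulus one differ by at most 2.\<close>

lemma cmod_char_distr_diff_le:
  fixes X Y :: "'a \<Rightarrow> real"
  assumes [measurable]: "random_variable borel X" "random_variable borel Y"
    and "0 \<le> e"
  shows "cmod (char (distr M borel Y) t - char (distr M borel X) t)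
    \<le> \<bar>t\<bar> * e + 2 * prob {\<omega>\<in>space M. e < \<bar>Y \<omega> - X \<omega>\<bar>}"
proof -
  let ?A = "{\<omega>\<in>space M. e < \<bar>Y \<omega> - X \<omega>\<bar>}"
  have int: "integrable M (\<lambda>\<omega>. iexp (t * X \<omega>))" "integrable M (\<lambda>\<omega>. iexp (t * Y \<omega>))"
    by (auto intro!: integrable_iexp)
  have ind: "integrable M (indicator ?A :: 'a \<Rightarrow> real)"
    by (rule integrable_real_indicator) (simp_all add: emeasure_eq_measure)
  have bound: "cmod (iexp (t * Y \<omega>) - iexp (t * X \<omega>)) \<le> \<bar>t\<bar> * e + 2 * indicator ?A \<omega>"
    if \<omega>: "\<omega> \<in> space M" for \<omega>
  proof -
    \<comment> \<open>Factoring out \<open>iexp (t * X \<omega>)\<close>, which has modulus one,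
      leaves only the increment \<open>Y \<omega> - X \<omega>\<close>. The two order-zero Taylor
      bounds for \<open>iexp\<close> then give 2 and
      \<open>\<bar>t\<bar> * \<bar>Y \<omega> - X \<omega>\<bar>\<close> respectively.\<close>
    have "iexp (t * Y \<omega>) - iexp (t * X \<omega>) = iexp (t * X \<omega>) * (iexp (t * (Y \<omega> - X \<omega>)) - 1)"
      by (simp add: algebra_simps flip: exp_add)
    then have eq: "cmod (iexp (t * Y \<omega>) - iexp (t * X \<omega>)) = cmod (iexp (t * (Y \<omega> - X \<omega>)) - 1)"
      by (simp add: norm_mult del: of_real_mult of_real_diff)
    show ?thesis
    proof (cases "\<omega> \<in> ?A")
      case True
      have "cmod (iexp (t * (Y \<omega> - X \<omega>)) - 1) \<le> 2"
        using iexp_approx2[of "t * (Y \<omega> - X \<omega>)" 0] by simp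
      then show ?thesis
        unfolding eq using True \<open>0 \<le> e\<close> by (simp add: add_increasing)
    next
      case False
      have "cmod (iexp (t * (Y \<omega> - X \<omega>)) - 1) \<le> \<bar>t\<bar> * \<bar>Y \<omega> - X \<omega>\<bar>"
        using iexp_approx1[of "t * (Y \<omega> - X \<omega>)" 0] by (simp add: abs_mult)
      also have "\<dots> \<le> \<bar>t\<bar> * e"
        using False \<omega> by (intro mult_left_mono) auto
      finally show ?thesis
        unfolding eq using False by simp
    qed
  qed
  have "char (distr M borel Y) t - char (distr M borel X) t
      = (CLINT \<omega>|M. iexp (t * Y \<omega>) - iexp (t * X \<omega>))"
    using int by (simp add: char_def integral_distr Bochner_Integration.integral_diff)
  also have "cmod \<dots> \<le> (\<integral>\<omega>. cmod (iexp (t * Y \<omega>) - iexp (t * X \<omega>)) \<partial>M)"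
    by (rule integral_norm_bound)
  also have "\<dots> \<le> (\<integral>\<omega>. \<bar>t\<bar> * e + 2 * indicator ?A \<omega> \<partial>M)"
  proof (rule integral_mono[OF _ _ bound])
    show "integrable M (\<lambda>\<omega>. cmod (iexp (t * Y \<omega>) - iexp (t * X \<omega>)))"
      using int by (intro integrable_norm Bochner_Integration.integrable_diff)
    show "integrable M (\<lambda>\<omega>. \<bar>t\<bar> * e + 2 * indicator ?A \<omega> :: real)"
      by (intro Bochner_Integration.integrable_add integrable_const integrable_mult_right ind)
  qed
  also have "\<dots> = \<bar>t\<bar> * e + 2 * prob ?A"
    by (subst Bochner_Integration.integral_add) (auto simp: prob_space ind)
  finally show ?thesis .
qed

text \<open>By Levy's continuity theorem it is enough that, at each fixed \<open>t\<close>, the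
  characteristic functions of \<open>X n\<close> and \<open>Y n\<close> have a vanishing difference,
  and the preceding bound reduces this to convergence in probability.\<close>

lemma weak_conv_m_slutsky:
  fixes X Y :: "nat \<Rightarrow> 'a \<Rightarrow> real"
  assumes X: "\<And>n. random_variable borel (X n)" and Y: "\<And>n. random_variable borel (Y n)"
    and N: "real_distribution N"
    and conv: "weak_conv_m (\<lambda>n. distr M borel (X n)) N"
    and diff: "conv_in_prob M (\<lambda>n \<omega>. Y n \<omega> - X n \<omega>) (\<lambda>_. 0)"
  shows "weak_conv_m (\<lambda>n. distr M borel (Y n)) N"
proof (rule levy_continuity)
  show "real_distribution (distr M borel (Y n))" for n
    by (rule real_distribution_distr[OF Y])
  show "real_distribution N" by (rule N)
  fix t :: real
  let ?c = "\<lambda>n. char (distr M borel (X n)) t"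
  let ?d = "\<lambda>n. char (distr M borel (Y n)) t - ?c n"
  have "?d \<longlonglongrightarrow> 0"
  proof (rule LIMSEQ_I)
    fix r :: real assume "0 < r"
    \<comment> \<open>This makes \<open>\<bar>t\<bar> * e\<close> smaller than \<open>r / 2\<close>;
      the \<open>+ 1\<close> keeps the denominator positive at \<open>t = 0\<close>. The other half
      of \<open>r\<close> is twice a probability below \<open>r / 4\<close>.\<close>
    define e where "e = r / (2 * (\<bar>t\<bar> + 1))"
    have "0 < e" using \<open>0 < r\<close> by (simp add: e_def)
    have "(\<bar>t\<bar> + 1) * e = r / 2"
      unfolding e_def by (simp add: field_simps)
    then have te: "\<bar>t\<bar> * e < r / 2"
      using \<open>0 < e\<close> by (simp add: algebra_simps)
    have "(\<lambda>n. prob {\<omega>\<in>space M. e < \<bar>Y n \<omega> - X n \<omega>\<bar>}) \<longlonglongrightarrow> 0"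
      using diff \<open>0 < e\<close> unfolding conv_in_prob_def by auto
    then have "\<forall>\<^sub>F n in sequentially. prob {\<omega>\<in>space M. e < \<bar>Y n \<omega> - X n \<omega>\<bar>} < r / 4"
      by (rule order_tendstoD) (use \<open>0 < r\<close> in simp)
    then have "\<forall>\<^sub>F n in sequentially. cmod (?d n) < r"
    proof eventually_elim
      case (elim n)
      then show ?case
        using cmod_char_distr_diff_le[OF X[of n] Y[of n], of e t] te \<open>0 < e\<close> by linarith
    qed
    then show "\<exists>n0. \<forall>n\<ge>n0. cmod (?d n - 0) < r"
      by (simp add: eventually_sequentially)
  qed
  moreover have "?c \<longlonglongrightarrow> char N t"
    using N conv by (intro levy_continuity1 real_distribution_distr X)
  ultimately have "(\<lambda>n. ?d n + ?c n) \<longlonglongrightarrow> 0 + char N t"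
    by (rule tendsto_add)
  then show "(\<lambda>n. char (distr M borel (Y n)) t) \<longlonglongrightarrow> char N t"
    by simp
qed

section \<open>Central limit theorem for triangular arrays\<close>

text \<open>This expectation is the Taylor error of the characteristic function of
  \<open>Y n\<close> at \<open>s n\<close>. As \<open>Y n\<close> changes with \<open>n\<close>,
  there need be no common dominating function; uniform integrability replaces it by one cutoff
  \<open>K\<close> for all \<open>n\<close>. Where the square exceeds \<open>K\<close>, the
  quadratic branch has a small expectation; elsewhere the cubic branch is at most
  \<open>\<bar>s n\<bar> * sqrt K\<close> times the square, which vanishes because second moments
  are bounded by \<open>C\<close>.\<close>

lemma expectation_min_square_cube_tendsto_0:
  fixes Y :: "nat \<Rightarrow> 'a \<Rightarrow> real"
  assumes [measurable]: "\<And>n. random_variable borel (Y n)"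
    and int: "\<And>n. integrable M (\<lambda>\<omega>. (Y n \<omega>)\<^sup>2)"
    and le: "\<And>n. expectation (\<lambda>\<omega>. (Y n \<omega>)\<^sup>2) \<le> C"
    and ui: "uniformly_integrable M UNIV (\<lambda>n \<omega>. (Y n \<omega>)\<^sup>2)"
    and s: "s \<longlonglongrightarrow> 0"
  shows "(\<lambda>n. expectation (\<lambda>\<omega>. min (6 * (Y n \<omega>)\<^sup>2) (\<bar>s n\<bar> * \<bar>Y n \<omega>\<bar> ^ 3))) \<longlonglongrightarrow> 0"
    (is "?E \<longlonglongrightarrow> 0")
proof (rule LIMSEQ_I)
  fix r :: real assume "0 < r"
  let ?S = "\<lambda>K::real. SUP n. \<integral>\<^sup>+\<omega>. ennreal \<bar>(Y n \<omega>)\<^sup>2\<bar> * indicator {\<omega>. K < \<bar>(Y n \<omega>)\<^sup>2\<bar>} \<omega> \<partial>M"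
  have "(?S \<longlongrightarrow> 0) at_top"
    using ui unfolding uniformly_integrable_def by simp
  \<comment> \<open>The tail enters the final estimate with the factor 6 of the quadratic branch, so
    \<open>r / 12\<close> contributes \<open>r / 2\<close>.\<close>
  then have "\<forall>\<^sub>F K in at_top. ?S K < ennreal (r / 12)"
    by (rule order_tendstoD) (use \<open>0 < r\<close> in simp)
  then have "\<forall>\<^sub>F K in at_top. 0 < K \<and> ?S K < ennreal (r / 12)"
    using eventually_gt_at_top[of 0] by eventually_elim simp
  then obtain K where K: "0 < K" "?S K < ennreal (r / 12)"
    using eventually_happens'[OF trivial_limit_at_top_linorder] by blast
  have tail: "expectation (\<lambda>\<omega>. (Y n \<omega>)\<^sup>2 * indicator {\<omega>. K < (Y n \<omega>)\<^sup>2} \<omega>) \<le> r / 12" for n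
  proof -
    have "(\<integral>\<^sup>+\<omega>. ennreal ((Y n \<omega>)\<^sup>2 * indicator {\<omega>. K < (Y n \<omega>)\<^sup>2} \<omega>) \<partial>M)
        = (\<integral>\<^sup>+\<omega>. ennreal \<bar>(Y n \<omega>)\<^sup>2\<bar> * indicator {\<omega>. K < \<bar>(Y n \<omega>)\<^sup>2\<bar>} \<omega> \<partial>M)"
      by (intro nn_integral_cong) (auto split: split_indicator)
    also have "\<dots> \<le> ?S K" by (rule SUP_upper) simp
    also have "\<dots> \<le> ennreal (r / 12)" using K by simp
    finally have "enn2real (\<integral>\<^sup>+\<omega>. ennreal ((Y n \<omega>)\<^sup>2 * indicator {\<omega>. K < (Y n \<omega>)\<^sup>2} \<omega>) \<partial>M) \<le> r / 12"
      by (rule enn2real_leI[rotated]) (use \<open>0 < r\<close> in simp)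
    then show ?thesis
      by (subst integral_eq_nn_integral) simp_all
  qed
  have bound: "?E n \<le> r / 2 + \<bar>s n\<bar> * sqrt K * C" for n
  proof -
    have pw: "min (6 * x\<^sup>2) (\<bar>s n\<bar> * \<bar>x\<bar> ^ 3)
        \<le> 6 * (x\<^sup>2 * (if K < x\<^sup>2 then 1 else 0)) + \<bar>s n\<bar> * sqrt K * x\<^sup>2" for x
    proof (cases "K < x\<^sup>2")
      case True
      then show ?thesis using K by (intro min.coboundedI1) simp
    next
      case False
      then have "\<bar>x\<bar> \<le> sqrt K" using real_le_rsqrt[of "\<bar>x\<bar>" K] by simp
      then have "\<bar>x\<bar> * x\<^sup>2 \<le> sqrt K * x\<^sup>2" by (rule mult_right_mono) simp
      moreover have "\<bar>x\<bar> ^ 3 = \<bar>x\<bar> * x\<^sup>2" by (simp add: power3_eq_cube power2_eq_square)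
      ultimately have "\<bar>s n\<bar> * \<bar>x\<bar> ^ 3 \<le> \<bar>s n\<bar> * (sqrt K * x\<^sup>2)"
        by (simp add: mult_left_mono)
      then show ?thesis using False by (simp add: mult.assoc min.coboundedI2)
    qed
    have int_tail: "integrable M (\<lambda>\<omega>. (Y n \<omega>)\<^sup>2 * indicator {\<omega>. K < (Y n \<omega>)\<^sup>2} \<omega>)"
      by (rule Bochner_Integration.integrable_bound[OF int[of n]])
        (auto split: split_indicator)
    have "?E n \<le> expectation (\<lambda>\<omega>. 6 * ((Y n \<omega>)\<^sup>2 * indicator {\<omega>. K < (Y n \<omega>)\<^sup>2} \<omega>)
        + \<bar>s n\<bar> * sqrt K * (Y n \<omega>)\<^sup>2)"
    proof (rule integral_mono)
      show "integrable M (\<lambda>\<omega>. min (6 * (Y n \<omega>)\<^sup>2) (\<bar>s n\<bar> * \<bar>Y n \<omega>\<bar> ^ 3))"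
        by (rule Bochner_Integration.integrable_bound[of _ "\<lambda>\<omega>. 6 * (Y n \<omega>)\<^sup>2"])
          (auto simp: int min_def)
      show "min (6 * (Y n \<omega>)\<^sup>2) (\<bar>s n\<bar> * \<bar>Y n \<omega>\<bar> ^ 3)
        \<le> 6 * ((Y n \<omega>)\<^sup>2 * indicator {\<omega>. K < (Y n \<omega>)\<^sup>2} \<omega>) + \<bar>s n\<bar> * sqrt K * (Y n \<omega>)\<^sup>2" for \<omega>
        using pw[of "Y n \<omega>"] by (simp only: indicator_def mem_Collect_eq of_bool_def)
    qed (intro Bochner_Integration.integrable_add integrable_mult_right int_tail int)
    also have "\<dots> = 6 * expectation (\<lambda>\<omega>. (Y n \<omega>)\<^sup>2 * indicator {\<omega>. K < (Y n \<omega>)\<^sup>2} \<omega>)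
        + \<bar>s n\<bar> * sqrt K * expectation (\<lambda>\<omega>. (Y n \<omega>)\<^sup>2)"
      by (simp add: int int_tail)
    also have "\<dots> \<le> 6 * (r / 12) + \<bar>s n\<bar> * sqrt K * C"
      using K by (intro add_mono mult_left_mono tail le) auto
    finally show ?thesis by simp
  qed
  have "(\<lambda>n. \<bar>s n\<bar> * sqrt K * C) \<longlonglongrightarrow> 0"
    using s by (auto intro!: tendsto_eq_intros)
  then have "\<forall>\<^sub>F n in sequentially. \<bar>s n\<bar> * sqrt K * C < r / 2"
    by (rule order_tendstoD) (use \<open>0 < r\<close> in simp)
  then have "\<forall>\<^sub>F n in sequentially. norm (?E n) < r"
  proof eventually_elim
    case (elim n)
    have "0 \<le> ?E n" by (rule integral_nonneg_AE) simp
    with elim bound[of n] show ?case by simp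
  qed
  then show "\<exists>n0. \<forall>n\<ge>n0. norm (?E n - 0) < r"
    by (simp add: eventually_sequentially)
qed

text \<open>Within a row, independence and equal laws make the characteristic function of the
  normalised sum a power of a single one. That power is compared with
  \<open>(1 - t^2 / (2 m))^m\<close>, where \<open>m\<close> is the row length, and the error is a
  constant times the expectation treated above. No joint behaviour of different rows enters.\<close>

theorem central_limit_theorem_triangular:
  fixes X :: "nat \<Rightarrow> 'i \<Rightarrow> 'a \<Rightarrow> real" and Y :: "nat \<Rightarrow> 'a \<Rightarrow> real" and A :: "nat \<Rightarrow> 'i set"
  assumes indep: "\<And>n. indep_vars (\<lambda>_. borel) (X n) (A n)"
    and distrib: "\<And>n i. i \<in> A n \<Longrightarrow> distr M borel (X n i) = distr M borel (Y n)"
    and Y_rv [measurable]: "\<And>n. random_variable borel (Y n)"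
    and mean: "\<And>n. expectation (Y n) = 0"
    and int: "\<And>n. integrable M (\<lambda>\<omega>. (Y n \<omega>)\<^sup>2)"
    and var: "\<And>n. expectation (\<lambda>\<omega>. (Y n \<omega>)\<^sup>2) = 1"
    and ui: "uniformly_integrable M UNIV (\<lambda>n \<omega>. (Y n \<omega>)\<^sup>2)"
    and card: "filterlim (\<lambda>n. card (A n)) at_top sequentially"
  shows "weak_conv_m (\<lambda>n. distr M borel (\<lambda>\<omega>. (\<Sum>i\<in>A n. X n i \<omega>) / sqrt (card (A n))))
    std_normal_distribution"
proof (rule levy_continuity)
  have X_rv [measurable]: "random_variable borel (X n i)" if "i \<in> A n" for n i
    using indep that by (auto simp: indep_vars_def2)
  then show "real_distribution (distr M borel (\<lambda>\<omega>. (\<Sum>i\<in>A n. X n i \<omega>) / sqrt (card (A n))))" for n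
    by (intro real_distribution_distr borel_measurable_divide borel_measurable_sum) auto
  show "real_distribution std_normal_distribution"
    by (rule real_dist_normal_dist)
  fix t :: real
  let ?m = "\<lambda>n. card (A n)"
  let ?s = "\<lambda>n. t / sqrt (?m n)"
  let ?\<phi> = "\<lambda>n. char (distr M borel (\<lambda>\<omega>. (\<Sum>i\<in>A n. X n i \<omega>) / sqrt (?m n))) t"
  let ?\<psi> = "\<lambda>n. char (distr M borel (Y n)) (?s n)"
  let ?E = "\<lambda>n. expectation (\<lambda>\<omega>. min (6 * (Y n \<omega>)\<^sup>2) (\<bar>?s n\<bar> * \<bar>Y n \<omega>\<bar> ^ 3))"
  \<comment> \<open>This also covers an infinite or empty \<open>A n\<close>: the cardinality is
    then 0, the sum is 0, and both sides equal 1.\<close>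
  have \<phi>_eq: "?\<phi> n = ?\<psi> n ^ ?m n" for n
  proof -
    have "?\<phi> n = char (distr M borel (\<lambda>\<omega>. \<Sum>i\<in>A n. X n i \<omega> / sqrt (?m n))) t"
      by (simp add: sum_divide_distrib)
    also have "\<dots> = (\<Prod>i\<in>A n. char (distr M borel (\<lambda>\<omega>. X n i \<omega> / sqrt (?m n))) t)"
      by (intro char_distr_sum indep_vars_compose2[OF indep]) simp
    also have "\<dots> = (\<Prod>i\<in>A n. ?\<psi> n)"
    proof (intro prod.cong refl)
      fix i assume i: "i \<in> A n"
      then have "char (distr M borel (\<lambda>\<omega>. X n i \<omega> / sqrt (?m n))) t = char (distr M borel (X n i)) (?s n)"
        using X_rv[OF i] by (simp add: char_def integral_distr)
      then show "char (distr M borel (\<lambda>\<omega>. X n i \<omega> / sqrt (?m n))) t = ?\<psi> n"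
        using distrib[OF i] by simp
    qed
    finally show ?thesis by simp
  qed
  have Y_int: "integrable M (Y n)" for n
    by (rule square_integrable_imp_integrable[OF Y_rv int])
  have card_real: "filterlim (\<lambda>n. real (?m n)) at_top sequentially"
    by (rule filterlim_compose[OF filterlim_real_sequentially card])
  \<comment> \<open>The threshold \<open>t\<^sup>2 / 4\<close> puts \<open>1 - t^2 / (2 m)\<close>
    into the interval from -1 to 1, as \<open>norm_power_diff\<close> demands; the threshold 1
    permits cancelling the row length.\<close>
  have main: "\<forall>\<^sub>F n in sequentially.
      cmod (?\<phi> n - (1 + (-(t\<^sup>2) / 2) / ?m n) ^ ?m n) \<le> t\<^sup>2 / 6 * ?E n"
    using filterlim_at_top[THEN iffD1, OF card_real, rule_format, of "t\<^sup>2 / 4"]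
      filterlim_at_top[THEN iffD1, OF card_real, rule_format, of 1]
  proof eventually_elim
    case (elim n)
    let ?a = "1 + (-(t\<^sup>2) / 2) / ?m n"
    have s2: "(?s n)\<^sup>2 = t\<^sup>2 / ?m n" by (simp add: power_divide)
    \<comment> \<open>Second-order Taylor expansion: the mean 0 removes the linear term and the
      variance 1 fixes the quadratic one.\<close>
    have "cmod (?\<psi> n - (1 - (?s n)\<^sup>2 * 1 / 2)) \<le> (?s n)\<^sup>2 / 6 * ?E n"
      using char_approx3'[OF Y_rv Y_int int mean _ refl, of n 1 "?s n"] by (simp add: mean var)
    then have 1: "cmod (?\<psi> n - of_real ?a) \<le> t\<^sup>2 / ?m n / 6 * ?E n"
      by (simp add: s2 mult.commute)
    \<comment> \<open>In the closed unit disc, taking \<open>m\<close>-th powers enlarges a distance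
      at most by the factor \<open>m\<close>. This factor cancels against the \<open>1 / m\<close>
      contained in the square of \<open>?s n\<close>.\<close>
    have "cmod (?\<psi> n ^ ?m n - of_real ?a ^ ?m n) \<le> ?m n * cmod (?\<psi> n - of_real ?a)"
    proof (rule norm_power_diff)
      show "cmod (?\<psi> n) \<le> 1"
        by (intro real_distribution.cmod_char_le_1 real_distribution_distr Y_rv)
      have "\<bar>?a\<bar> \<le> 1" using elim by (intro abs_leI) (auto simp: field_simps)
      then show "cmod (of_real ?a) \<le> 1" by (simp only: norm_of_real)
    qed
    also have "\<dots> \<le> ?m n * (t\<^sup>2 / ?m n / 6 * ?E n)"
      using 1 by (rule mult_left_mono) simp
    also have "\<dots> = t\<^sup>2 / 6 * ?E n"
      using elim by (simp add: field_simps)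
    finally show ?case by (simp add: \<phi>_eq)
  qed
  have "?s \<longlonglongrightarrow> 0"
    by (intro tendsto_divide_0[OF tendsto_const] filterlim_at_top_imp_at_infinity
        filterlim_compose[OF sqrt_at_top card_real])
  then have "?E \<longlonglongrightarrow> 0"
    using var by (intro expectation_min_square_cube_tendsto_0[where C = 1] int ui) auto
  then have E: "(\<lambda>n. t\<^sup>2 / 6 * ?E n) \<longlonglongrightarrow> 0"
    by (rule tendsto_mult_right_zero)
  have "(\<lambda>n. (1 + (-(t\<^sup>2) / 2) / real n) ^ n) \<longlonglongrightarrow> exp (-(t\<^sup>2) / 2)"
    by (rule tendsto_exp_limit_sequentially)
  then have "(\<lambda>n. (1 + (-(t\<^sup>2) / 2) / real (?m n)) ^ ?m n) \<longlonglongrightarrow> exp (-(t\<^sup>2) / 2)"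
    by (rule filterlim_compose[OF _ card])
  then have "(\<lambda>n. complex_of_real ((1 + (-(t\<^sup>2) / 2) / real (?m n)) ^ ?m n)) \<longlonglongrightarrow> of_real (exp (-(t\<^sup>2) / 2))"
    by (rule tendsto_of_real)
  then have "?\<phi> \<longlonglongrightarrow> of_real (exp (-(t\<^sup>2) / 2))"
    by (rule Lim_transform) (rule Lim_null_comparison[OF _ E], use main in simp)
  then show "?\<phi> \<longlonglongrightarrow> char std_normal_distribution t"
    by (simp add: char_std_normal_distribution)
qed

end

section \<open>Cross-validation error\<close>

text \<open>It serves for the \<open>hbar\<close> terms, which depend on the point alone. The loss
  terms also depend on the training vector of their fold and stay double sums.\<close>

lemma cv_splits_sum_validation:
  fixes f :: "nat \<Rightarrow> 'b::comm_monoid_add"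
  assumes "cv_splits n k B B'"
  shows "(\<Sum>j=1..k. \<Sum>i\<in>set (B' j). f i) = (\<Sum>i=1..n. f i)"
proof -
  have "(\<Sum>j=1..k. \<Sum>i\<in>set (B' j). f i) = (\<Sum>i\<in>(\<Union>j\<in>{1..k}. set (B' j)). f i)"
    using assms unfolding cv_splits_def disjoint_family_on_def
    by (intro sum.UNION_disjoint[symmetric]) auto
  also have "(\<Union>j\<in>{1..k}. set (B' j)) = {1..n}"
    using assms unfolding cv_splits_def by blast
  finally show ?thesis .
qed

theorem theorem1:
  fixes M :: "'a measure" and S :: "'z measure"
    and Z :: "nat \<Rightarrow> 'a \<Rightarrow> 'z" and Z0 :: "'a \<Rightarrow> 'z"
    and k :: "nat \<Rightarrow> nat" and B B' :: "nat \<Rightarrow> nat \<Rightarrow> nat list"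
    and h :: "nat \<Rightarrow> 'z \<Rightarrow> (nat \<Rightarrow> 'z) \<Rightarrow> real" and hbar :: "nat \<Rightarrow> 'z \<Rightarrow> real"
    and \<sigma> :: "nat \<Rightarrow> real"
  assumes "prob_space M"
    and "Z0 \<in> measurable M S"
    and "prob_space.indep_vars M (\<lambda>_. S) Z {1..}"
    and "\<And>i. 1 \<le> i \<Longrightarrow> distr M S (Z i) = distr M S Z0"
    and "\<And>n. 2 \<le> n \<Longrightarrow> cv_splits n (k n) (B n) (B' n)"
    and "\<And>n. 2 \<le> n \<Longrightarrow>
      (\<lambda>(z, v). h n z v) \<in> borel_measurable (S \<Otimes>\<^sub>M vec_space S (n - n div k n))"
    and "\<And>n j i. 2 \<le> n \<Longrightarrow> j \<in> {1..k n} \<Longrightarrow> i \<in> set (B' n j) \<Longrightarrow>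
      cond_integrable M (sigma_subvector M S Z (B n j)) (loss_at (h n) Z (B n j) i)"
    and "\<And>n. 2 \<le> n \<Longrightarrow> hbar n \<in> borel_measurable S"
    and "\<And>n. 2 \<le> n \<Longrightarrow> integrable M (\<lambda>\<omega>. hbar n (Z0 \<omega>))"
    and "\<And>n. 2 \<le> n \<Longrightarrow>
      integrable M (\<lambda>\<omega>. (hbar n (Z0 \<omega>) - prob_space.expectation M (\<lambda>\<omega>. hbar n (Z0 \<omega>)))\<^sup>2)"
    and "\<And>n. 2 \<le> n \<Longrightarrow> (\<sigma> n)\<^sup>2 = prob_space.variance M (\<lambda>\<omega>. hbar n (Z0 \<omega>))"
    and "\<And>n. 2 \<le> n \<Longrightarrow> 0 < \<sigma> n"
    and "uniformly_integrable M {2..}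
      (\<lambda>n \<omega>. (hbar n (Z0 \<omega>) - prob_space.expectation M (\<lambda>\<omega>. hbar n (Z0 \<omega>)))\<^sup>2 / (\<sigma> n)\<^sup>2)"
    and "conv_in_prob M
      (\<lambda>n \<omega>. 1 / (\<sigma> n * sqrt (real n)) *
        (\<Sum>j=1..k n. \<Sum>i\<in>set (B' n j).
          loss_at (h n) Z (B n j) i \<omega> - cond_loss M S (h n) Z (B n j) i \<omega>
          - (hbar n (Z i \<omega>) - prob_space.expectation M (\<lambda>\<omega>. hbar n (Z i \<omega>)))))
      (\<lambda>_. 0)"
  shows "weak_conv_m
    (\<lambda>n. distr M borel (\<lambda>\<omega>. sqrt (real n) / \<sigma> n *
      (cv_error n (k n) (B n) (B' n) (h n) Z \<omega> - cv_test_error M S n (k n) (B n) (B' n) (h n) Z \<omega>)))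
    std_normal_distribution"
proof -
  interpret prob_space M by fact
  note Z0 = assms(2) and indep = assms(3) and id_distr = assms(4) and splits = assms(5)
  define \<mu> where "\<mu> n = expectation (\<lambda>\<omega>. hbar n (Z0 \<omega>))" for n
  have hbar [measurable]: "hbar (n + 2) \<in> borel_measurable S" for n
    by (rule assms(8)) simp
  have Z: "random_variable S (Z i)" if "1 \<le> i" for i
    using indep that by (auto simp: indep_vars_def2)
  \<comment> \<open>The remainder in the hypothesis centres \<open>hbar\<close> at the mean under
    \<open>Z i\<close>, whereas variance and uniform integrability are stated for \<open>Z0\<close>;
    equality of laws identifies the two means.\<close>
  have mean_Z: "expectation (\<lambda>\<omega>. hbar (n + 2) (Z i \<omega>)) = \<mu> (n + 2)" if "1 \<le> i" for n i
    using id_distr[OF that] unfolding \<mu>_def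
    by (metis integral_distr[OF Z[OF that] hbar] integral_distr[OF Z0 hbar])
  define g where "g n z = (hbar n z - \<mu> n) / \<sigma> n" for n z
  have g [measurable]: "g (n + 2) \<in> borel_measurable S" for n
    unfolding g_def by measurable
  have \<sigma>: "0 < \<sigma> (n + 2)" for n
    by (rule assms(12)) simp
  \<comment> \<open>The hypotheses hold from sample size 2 on, but the limit theorems ask for every
    index. Hence all sequences are shifted by 2, and \<open>weak_conv_m_offset\<close> undoes the
    shift at the end.\<close>
  have clt: "weak_conv_m (\<lambda>n. distr M borel
      (\<lambda>\<omega>. (\<Sum>i\<in>{1..n+2}. g (n + 2) (Z i \<omega>)) / sqrt (card {1..n+2}))) std_normal_distribution"
  proof (rule central_limit_theorem_triangular)
    show "indep_vars (\<lambda>_. borel) (\<lambda>i \<omega>. g (n + 2) (Z i \<omega>)) {1..n+2}" for n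
      by (rule indep_vars_compose2[OF indep_vars_subset[OF indep]], force, rule g)
    show "distr M borel (\<lambda>\<omega>. g (n + 2) (Z i \<omega>)) = distr M borel (\<lambda>\<omega>. g (n + 2) (Z0 \<omega>))"
      if "i \<in> {1..n+2}" for n i
    proof -
      have i: "1 \<le> i" using that by simp
      have "distr (distr M S (Z i)) borel (g (n + 2)) = distr (distr M S Z0) borel (g (n + 2))"
        by (simp only: id_distr[OF i])
      then show ?thesis
        by (simp only: distr_distr[OF g Z[OF i]] distr_distr[OF g Z0] comp_def)
    qed
    show "random_variable borel (\<lambda>\<omega>. g (n + 2) (Z0 \<omega>))" for n
      using Z0 by measurable
    have int: "integrable M (\<lambda>\<omega>. hbar (n + 2) (Z0 \<omega>))" for n
      by (rule assms(9)) simp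
    show "expectation (\<lambda>\<omega>. g (n + 2) (Z0 \<omega>)) = 0" for n
      using int[of n] by (simp add: g_def prob_space flip: \<mu>_def)
    have sq: "(g n z)\<^sup>2 = (hbar n z - \<mu> n)\<^sup>2 / (\<sigma> n)\<^sup>2" for n z
      by (simp add: g_def power_divide)
    have int2: "integrable M (\<lambda>\<omega>. (hbar (n + 2) (Z0 \<omega>) - \<mu> (n + 2))\<^sup>2)" for n
      unfolding \<mu>_def by (rule assms(10)) simp
    then show "integrable M (\<lambda>\<omega>. (g (n + 2) (Z0 \<omega>))\<^sup>2)" for n
      by (simp add: sq)
    have var: "expectation (\<lambda>\<omega>. (hbar (n + 2) (Z0 \<omega>) - \<mu> (n + 2))\<^sup>2) = (\<sigma> (n + 2))\<^sup>2" for n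
      unfolding \<mu>_def by (rule assms(11)[symmetric]) simp
    show "expectation (\<lambda>\<omega>. (g (n + 2) (Z0 \<omega>))\<^sup>2) = 1" for n
      using \<sigma>[of n] by (simp only: sq integral_divide_zero var) simp
    \<comment> \<open>Uniform integrability is assumed over \<open>{2..}\<close>, which is exactly
      the range of the shift, so it can be reindexed to all naturals.\<close>
    have "range (\<lambda>n::nat. n + 2) \<subseteq> {2..}" by auto
    moreover have "m \<in> range (\<lambda>n::nat. n + 2)" if "2 \<le> m" for m
      using that by (intro image_eqI[of _ _ "m - 2"]) auto
    ultimately have "range (\<lambda>n::nat. n + 2) = {2..}" by auto
    then show "uniformly_integrable M UNIV (\<lambda>n \<omega>. (g (n + 2) (Z0 \<omega>))\<^sup>2)"
      using assms(13) unfolding sq \<mu>_def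
      by (intro uniformly_integrable_reindex[where f = "\<lambda>n. n + 2"]) simp
    show "filterlim (\<lambda>n. card {1..n+2}) at_top sequentially"
      by (simp add: filterlim_sequentially_Suc filterlim_Suc)
  qed
  define D where "D n \<omega> = sqrt (real n) / \<sigma> n *
      (cv_error n (k n) (B n) (B' n) (h n) Z \<omega> - cv_test_error M S n (k n) (B n) (B' n) (h n) Z \<omega>)"
    for n \<omega>
  have "weak_conv_m (\<lambda>n. distr M borel (D (n + 2))) std_normal_distribution"
  proof (rule weak_conv_m_slutsky[OF _ _ real_dist_normal_dist clt])
    show "random_variable borel (\<lambda>\<omega>. (\<Sum>i\<in>{1..n+2}. g (n + 2) (Z i \<omega>)) / sqrt (card {1..n+2}))" for n
      by (intro borel_measurable_divide borel_measurable_sum measurable_compose[OF Z g]) auto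
    show "random_variable borel (D (n + 2))" for n
    proof -
      \<comment> \<open>Measurability of each loss is part of \<open>cond_integrable\<close>;
        \<open>real_cond_exp\<close> is always measurable.\<close>
      have "random_variable borel (loss_at (h (n + 2)) Z (B (n + 2) j) i)"
        if "j \<in> {1..k (n + 2)}" "i \<in> set (B' (n + 2) j)" for j i
        using assms(7)[OF _ that] by (simp add: cond_integrable_def)
      moreover have "random_variable borel (cond_loss M S (h (n + 2)) Z (B (n + 2) j) i)" for j i
        by (simp add: cond_loss_def)
      ultimately show ?thesis
        unfolding D_def cv_error_def cv_test_error_def
        by (intro borel_measurable_times borel_measurable_diff borel_measurable_sum) auto
    qed
    \<comment> \<open>An exact identity: the gap between the scaled deviation and the normalised
      i.i.d. sum is the remainder that the hypothesis sends to 0, so Slutsky's lemma needs no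
      further estimate.\<close>
    have eq: "D (n + 2) \<omega> - (\<Sum>i\<in>{1..n+2}. g (n + 2) (Z i \<omega>)) / sqrt (card {1..n+2})
        = 1 / (\<sigma> (n + 2) * sqrt (real (n + 2))) *
        (\<Sum>j=1..k (n + 2). \<Sum>i\<in>set (B' (n + 2) j).
          loss_at (h (n + 2)) Z (B (n + 2) j) i \<omega> - cond_loss M S (h (n + 2)) Z (B (n + 2) j) i \<omega>
          - (hbar (n + 2) (Z i \<omega>) - expectation (\<lambda>\<omega>. hbar (n + 2) (Z i \<omega>))))" for n \<omega>
    proof -
      define m where "m = n + 2"
      have split: "cv_splits m (k m) (B m) (B' m)"
        by (rule splits) (simp add: m_def)
      let ?L = "\<Sum>j=1..k m. \<Sum>i\<in>set (B' m j). loss_at (h m) Z (B m j) i \<omega>"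
      let ?C = "\<Sum>j=1..k m. \<Sum>i\<in>set (B' m j). cond_loss M S (h m) Z (B m j) i \<omega>"
      let ?H = "\<Sum>i=1..m. hbar m (Z i \<omega>) - \<mu> m"
      have H: "(\<Sum>j=1..k m. \<Sum>i\<in>set (B' m j). hbar m (Z i \<omega>) - expectation (\<lambda>\<omega>. hbar m (Z i \<omega>))) = ?H"
        unfolding cv_splits_sum_validation[OF split]
        by (intro sum.cong refl) (simp add: mean_Z[of _ n, folded m_def])
      \<comment> \<open>The factor \<open>1 / m\<close> of both error averages meets
        \<open>sqrt m\<close>, leaving the normalisation \<open>1 / sqrt m\<close> of the
        hypothesis.\<close>
      have "D m \<omega> = sqrt (real m) / real m * (?L - ?C) / \<sigma> m"
        by (simp add: D_def cv_error_def cv_test_error_def flip: diff_divide_distrib)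
      also have "\<dots> = (?L - ?C) / (\<sigma> m * sqrt (real m))"
        by (simp add: sqrt_divide_self_eq, simp add: field_simps)
      finally have "D m \<omega> = (?L - ?C) / (\<sigma> m * sqrt (real m))" .
      moreover have "(\<Sum>i\<in>{1..m}. g m (Z i \<omega>)) / sqrt (card {1..m}) = ?H / (\<sigma> m * sqrt (real m))"
        by (simp add: g_def sum_divide_distrib)
      ultimately have "D m \<omega> - (\<Sum>i\<in>{1..m}. g m (Z i \<omega>)) / sqrt (card {1..m})
          = 1 / (\<sigma> m * sqrt (real m)) * (?L - ?C - ?H)"
        by (simp add: diff_divide_distrib)
      then show ?thesis
        unfolding m_def[symmetric] sum_subtractf H[unfolded sum_subtractf] by simp
    qed
    show "conv_in_prob M (\<lambda>n \<omega>. D (n + 2) \<omega>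
        - (\<Sum>i\<in>{1..n+2}. g (n + 2) (Z i \<omega>)) / sqrt (card {1..n+2})) (\<lambda>_. 0)"
      unfolding eq by (rule conv_in_prob_shift[OF assms(14)])
  qed
  then have "weak_conv_m (\<lambda>n. distr M borel (D n)) std_normal_distribution"
    by (rule weak_conv_m_offset)
  then show ?thesis
    unfolding D_def .
qed

end
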